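(* Let $X$ be a Banach space, let $0<p<+\infty$, and let $\sum_i x_i$ be a series in $X$. The following conditions are equivalent: (1) $\sum_i x_i$ is a weakly unconditionally Cauchy series. (2) $S_{w-\mathrm{w}_p}\left(\sum_i x_i\right)$ is a complete space. (3) $c_0\subset S_{w-\mathrm{w}_p}\left(\sum_i x_i\right)$.
   Context: A sequence $(y_k)_k$ in a normed space $X$ is weak $\mathrm{w}_p$-summable (written $w-\mathrm{w}_p$ summable) to $L\in X$ if for every $f\in X^*$, $\lim_n\frac1n\sum_{k=1}^n|f(y_k)-f(L)|^p=0$; it is $w-\mathrm{w}_p$ summable if this holds for some $L\in X$. A series $\sum_i y_i$ in $X$ is called $w-\mathrm{w}_p$ summable if its sequence of partial sums $\left(\sum_{i=1}^k y_i\right)_k$ is. A series $\sum_i x_i$ in $X$ is weakly unconditionally Cauchy (wuc) if $\sum_{i=1}^\infty |f(x_i)|<\infty$ for every $f\in X^*$. For a series $\sum_i x_i$ in $X$, $$S_{w-\mathrm{w}_p}\left(\sum_i x_i\right)=\left\{(a_i)_i\in\ell_\infty:\ \sum_i a_i x_i \text{ is } w-\mathrm{w}_p \text{ summable}\right\},$$ endowed with the supremum norm; $\ell_\infty$ is the space of bounded scalar sequences and $c_0$ its subspace of null sequences. *)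

theory Defs
  imports "HOL-Analysis.Analysis"
begin

text \<open>
  The scalar field is a type \<open>'k\<close> of sort \<open>{real_normed_field, euclidean_space}\<close>. By Frobenius'
  theorem the only such fields are the real and the complex numbers, so statements over \<open>'k\<close> cover
  real and complex normed spaces at once. The class \<^class>\<open>real_normed_vector\<close> provides only real
  scalars; multiplication by elements of \<open>'k\<close> is therefore an explicit parameter, compatible with
  the real scalar multiplication and the norm of the type.
\<close>

locale normed_space_over = vector_space sc
  for sc :: "'k::{real_normed_field, euclidean_space} \<Rightarrow> 'a::real_normed_vector \<Rightarrow> 'a" +
  assumes norm_scale: "norm (sc c x) = norm c * norm x"
    and scale_of_real: "sc (of_real r) x = r *\<^sub>R x"

lemma normed_space_over_scaleR:
  "normed_space_over ((*\<^sub>R) :: real \<Rightarrow> 'a::real_normed_vector \<Rightarrow> 'a)"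
  by unfold_locales (auto simp: algebra_simps)

lemma normed_space_over_complex:
  "normed_space_over ((*) :: complex \<Rightarrow> complex \<Rightarrow> complex)"
  by unfold_locales (auto simp: algebra_simps norm_mult scaleR_conv_of_real)

definition dual_space ::
    "('k::{real_normed_field, euclidean_space} \<Rightarrow> 'a::real_normed_vector \<Rightarrow> 'a) \<Rightarrow> ('a \<Rightarrow> 'k) set" where
  "dual_space sc =
     {f. Vector_Spaces.linear sc (*) f \<and> (\<exists>K. \<forall>x. norm (f x) \<le> K * norm x)}"

text \<open>
  Sequences and series are indexed from 0, so the first \<open>n\<close> terms of \<open>y\<close> are \<open>y 0, \<dots>, y (n - 1)\<close>.
\<close>

definition weak_wp_summable_to ::
    "('k::{real_normed_field, euclidean_space} \<Rightarrow> 'a::real_normed_vector \<Rightarrow> 'a) \<Rightarrow> real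
      \<Rightarrow> (nat \<Rightarrow> 'a) \<Rightarrow> 'a \<Rightarrow> bool" where
  "weak_wp_summable_to sc p y L \<longleftrightarrow>
     (\<forall>f\<in>dual_space sc.
        (\<lambda>n. (1 / real n) * (\<Sum>k<n. norm (f (y k) - f L) powr p)) \<longlonglongrightarrow> 0)"

definition weak_wp_summable ::
    "('k::{real_normed_field, euclidean_space} \<Rightarrow> 'a::real_normed_vector \<Rightarrow> 'a) \<Rightarrow> real
      \<Rightarrow> (nat \<Rightarrow> 'a) \<Rightarrow> bool" where
  "weak_wp_summable sc p y \<longleftrightarrow> (\<exists>L. weak_wp_summable_to sc p y L)"

definition weak_wp_summable_series ::
    "('k::{real_normed_field, euclidean_space} \<Rightarrow> 'a::real_normed_vector \<Rightarrow> 'a) \<Rightarrow> real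
      \<Rightarrow> (nat \<Rightarrow> 'a) \<Rightarrow> bool" where
  "weak_wp_summable_series sc p y \<longleftrightarrow> weak_wp_summable sc p (\<lambda>k. \<Sum>i\<le>k. y i)"

definition weakly_unconditionally_Cauchy ::
    "('k::{real_normed_field, euclidean_space} \<Rightarrow> 'a::real_normed_vector \<Rightarrow> 'a)
      \<Rightarrow> (nat \<Rightarrow> 'a) \<Rightarrow> bool" where
  "weakly_unconditionally_Cauchy sc x \<longleftrightarrow>
     (\<forall>f\<in>dual_space sc. summable (\<lambda>i. norm (f (x i))))"

text \<open>
  As \<^typ>\<open>nat\<close> is discrete, \<open>nat \<Rightarrow>\<^sub>C 'k\<close> consists of all bounded sequences, and its norm is the
  supremum norm: it is the space \<open>l\<^sub>\<infinity>\<close>.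
\<close>

definition summability_space ::
    "('k::{real_normed_field, euclidean_space} \<Rightarrow> 'a::real_normed_vector \<Rightarrow> 'a) \<Rightarrow> real
      \<Rightarrow> (nat \<Rightarrow> 'a) \<Rightarrow> (nat \<Rightarrow>\<^sub>C 'k) set" where
  "summability_space sc p x =
     {a. weak_wp_summable_series sc p (\<lambda>i. sc (apply_bcontfun a i) (x i))}"

definition null_sequences :: "(nat \<Rightarrow>\<^sub>C 'k::real_normed_vector) set" where
  "null_sequences = {a. apply_bcontfun a \<longlonglongrightarrow> 0}"

end

theory Submission
  imports Defs
begin

text \<open>
  For a weakly unconditionally Cauchy series, \<open>\<Sum>i. a i * f (x i)\<close> converges absolutely for every
  bounded \<open>a\<close> and every functional \<open>f\<close>, so weak \<open>p\<close>-Cesaro summability of the partial sums to \<open>L\<close>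
  just says that this sum is \<open>f L\<close>. By uniform boundedness \<open>\<Sum>i. norm (f (x i))\<close> is bounded over
  the functionals of norm at most \<open>1\<close>, so by Hahn-Banach \<open>L\<close> is a Lipschitz function of \<open>a\<close>, and
  completeness of the space of values makes the summability space closed. A closed summability space
  contains the null sequences, because these are limits of finitely supported ones. Finally, if
  \<open>S k = (\<Sum>i\<le>k. norm (f (x i)))\<close> is unbounded for some \<open>f\<close>, the null sequence with entries of
  modulus \<open>1 / sqrt (1 + S i)\<close> and the phases that make all \<open>a i * f (x i)\<close> nonnegative drives
  the partial sums of \<open>\<Sum>i. a i * f (x i)\<close> to infinity, and so it is not in the summability space.
\<close>

section \<open>Hahn-Banach via minimal sublinear functionals\<close>

definition sublinear :: "('a::real_vector \<Rightarrow> real) \<Rightarrow> bool" where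
  "sublinear q \<longleftrightarrow> (\<forall>x y. q (x + y) \<le> q x + q y) \<and> (\<forall>r\<ge>0. \<forall>x. q (r *\<^sub>R x) = r * q x)"

text \<open>Applying \<open>scale\<close> to \<open>inverse r\<close> and
  \<open>r *\<^sub>R x\<close> yields the reverse inequality, so one-sided homogeneity
  suffices.\<close>

lemma sublinearI:
  assumes add: "\<And>x y. q (x + y) \<le> q x + q y"
    and scale: "\<And>r x. 0 < r \<Longrightarrow> q (r *\<^sub>R x) \<le> r * q x"
    and zero: "q 0 = 0"
  shows "sublinear q"
proof -
  have "q (r *\<^sub>R x) = r * q x" if "0 \<le> r" for r x
  proof (cases "r = 0")
    case False
    with that have r: "0 < r" by simp
    have "q x \<le> inverse r * q (r *\<^sub>R x)"
      using scale[of "inverse r" "r *\<^sub>R x"] r by simp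
    then have "r * q x \<le> q (r *\<^sub>R x)"
      using r by (simp add: field_simps)
    with scale[OF r, of x] show ?thesis by simp
  qed (simp add: zero)
  with add show ?thesis by (auto simp: sublinear_def)
qed

lemma sublinear_add: "sublinear q \<Longrightarrow> q (x + y) \<le> q x + q y"
  by (simp add: sublinear_def)

lemma sublinear_scale: "sublinear q \<Longrightarrow> 0 \<le> r \<Longrightarrow> q (r *\<^sub>R x) = r * q x"
  by (simp add: sublinear_def)

lemma sublinear_zero: "sublinear q \<Longrightarrow> q 0 = 0"
  using sublinear_scale[of q 0 0] by simp

lemma sublinear_ge: "sublinear q \<Longrightarrow> - q (- x) \<le> q x"
  using sublinear_add[of q x "- x"] sublinear_zero[of q] by simp

lemma sublinear_norm: "sublinear (norm :: 'a::real_normed_vector \<Rightarrow> real)"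
  by (auto simp: sublinear_def norm_triangle_ineq)

text \<open>Take the infimum over \<open>t \<ge> 0\<close> of
  \<open>q (x + t *\<^sub>R z) - t * q z\<close>: the choice \<open>t = 0\<close> keeps it below
  \<open>q\<close>, and \<open>t = 1\<close> at \<open>- z\<close> gives \<open>q 0 - q z\<close>.
  It serves twice: to show that minimal functionals are odd and to fix the value of a functional at
  \<open>z\<close>.\<close>

lemma sublinear_directional_infimum:
  fixes q :: "'a::real_vector \<Rightarrow> real"
  assumes q: "sublinear q"
  shows "\<exists>q'. sublinear q' \<and> q' \<le> q \<and> q' (- z) \<le> - q z"
proof -
  define h where "h x t = q (x + t *\<^sub>R z) - t * q z" for x t
  define q' where "q' x = (INF t\<in>{0..}. h x t)" for x
  \<comment> \<open>From \<open>t *\<^sub>R z = (x + t *\<^sub>R z) + (- x)\<close>; this keeps the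
    infimum finite.\<close>
  have bound: "- q (- x) \<le> h x t" if "0 \<le> t" for x t
    using sublinear_add[OF q, of "x + t *\<^sub>R z" "- x"] sublinear_scale[OF q that, of z]
    by (simp add: h_def)
  have lower: "q' x \<le> h x t" if "0 \<le> t" for x t
    unfolding q'_def using bound that by (intro cINF_lower bdd_belowI2) auto
  have greatest: "c \<le> q' x" if "\<And>t. 0 \<le> t \<Longrightarrow> c \<le> h x t" for c x
    unfolding q'_def using that by (intro cINF_greatest) auto
  have "sublinear q'"
  proof (rule sublinearI)
    fix x y
    have "q' (x + y) \<le> h x s + h y t" if "0 \<le> s" "0 \<le> t" for s t
    proof -
      have "q' (x + y) \<le> h (x + y) (s + t)"
        using that by (intro lower) simp
      also have "\<dots> \<le> h x s + h y t"
        using sublinear_add[OF q, of "x + s *\<^sub>R z" "y + t *\<^sub>R z"]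
        by (simp add: h_def algebra_simps)
      finally show ?thesis .
    qed
    \<comment> \<open>The infimum over \<open>s\<close> is taken with \<open>t\<close> fixed, then
      the one over \<open>t\<close>.\<close>
    then have "q' (x + y) - h y t \<le> q' x" if "0 \<le> t" for t
      using that by (intro greatest) (simp add: algebra_simps)
    then have "q' (x + y) - q' x \<le> q' y"
      by (intro greatest) (simp add: algebra_simps)
    then show "q' (x + y) \<le> q' x + q' y" by simp
  next
    fix r :: real and x assume r: "0 < r"
    have "q' (r *\<^sub>R x) / r \<le> q' x"
    proof (rule greatest)
      fix t :: real assume t: "0 \<le> t"
      have "q' (r *\<^sub>R x) \<le> h (r *\<^sub>R x) (r * t)"
        using r t by (intro lower) simp
      also have "\<dots> = r * h x t"
        using sublinear_scale[OF q, of r "x + t *\<^sub>R z"] r by (simp add: h_def algebra_simps)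
      finally show "q' (r *\<^sub>R x) / r \<le> h x t"
        using r by (simp add: field_simps)
    qed
    then show "q' (r *\<^sub>R x) \<le> r * q' x"
      using r by (simp add: field_simps)
  next
    have "h 0 t = 0" if "0 \<le> t" for t
      using sublinear_scale[OF q that, of z] by (simp add: h_def)
    then show "q' 0 = 0"
      using lower[of 0 0] greatest[of 0 0] by simp
  qed
  moreover have "q' \<le> q"
    using lower[of 0] by (auto simp: le_fun_def h_def)
  moreover have "q' (- z) \<le> - q z"
    using lower[of 1 "- z"] sublinear_zero[OF q] by (simp add: h_def)
  ultimately show ?thesis by blast
qed

text \<open>Zorn's lemma for the reversed pointwise order. A nonempty chain has its pointwise
  infimum as lower bound, finite because every member stays above \<open>- q (- x)\<close>.\<close>

lemma minimal_sublinear_below: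
  fixes q :: "'a::real_vector \<Rightarrow> real"
  assumes q: "sublinear q"
  shows "\<exists>m. sublinear m \<and> m \<le> q \<and> (\<forall>q'. sublinear q' \<longrightarrow> q' \<le> m \<longrightarrow> q' = m)"
proof -
  define A where "A = {q'. sublinear q' \<and> q' \<le> q}"
  have "\<exists>m\<in>A. \<forall>a\<in>A. a \<le> m \<longrightarrow> a = m"
  proof (rule predicate_Zorn[where P = "\<lambda>a b. b \<le> a"])
    show "partial_order_on A (relation_of (\<lambda>a b. b \<le> a) A)"
      by (rule partial_order_on_relation_ofI) auto
    fix C assume C: "C \<in> Chains (relation_of (\<lambda>a b. b \<le> a) A)"
    then have CA: "C \<subseteq> A" and chain: "\<And>a b. a \<in> C \<Longrightarrow> b \<in> C \<Longrightarrow> a \<le> b \<or> b \<le> a"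
      by (auto simp: Chains_def relation_of_def)
    show "\<exists>u\<in>A. \<forall>a\<in>C. u \<le> a"
    proof (cases "C = {}")
      case True
      then show ?thesis using q by (auto simp: A_def)
    next
      case False
      define i where "i x = (INF a\<in>C. a x)" for x
      have bound: "- q (- x) \<le> a x" if "a \<in> C" for a x
      proof -
        have "- q (- x) \<le> - a (- x)" using that CA by (auto simp: A_def le_fun_def)
        also have "\<dots> \<le> a x" using that CA by (intro sublinear_ge) (auto simp: A_def)
        finally show ?thesis .
      qed
      have lower: "i x \<le> a x" if "a \<in> C" for a x
        unfolding i_def using bound that by (intro cINF_lower bdd_belowI2) auto
      have greatest: "c \<le> i x" if "\<And>a. a \<in> C \<Longrightarrow> c \<le> a x" for c x
        unfolding i_def using that False by (intro cINF_greatest) auto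
      have sub: "sublinear a" if "a \<in> C" for a
        using that CA by (auto simp: A_def)
      have "sublinear i"
      proof (rule sublinearI)
        fix x y
        have "i (x + y) \<le> a x + b y" if ab: "a \<in> C" "b \<in> C" for a b
        proof -
          \<comment> \<open>The smaller of \<open>a\<close> and \<open>b\<close> serves for both
            arguments; this is where the chain property enters.\<close>
          obtain c where c: "c \<in> C" "c \<le> a" "c \<le> b"
            using chain[OF ab] ab by blast
          have "i (x + y) \<le> c x + c y"
            using lower[OF c(1), of "x + y"] sublinear_add[OF sub[OF c(1)], of x y] by simp
          also have "\<dots> \<le> a x + b y"
            using c(2,3) by (simp add: le_fun_def add_mono)
          finally show ?thesis .
        qed
        then have "i (x + y) - b y \<le> i x" if "b \<in> C" for b
          using that by (intro greatest) (simp add: algebra_simps)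
        then have "i (x + y) - i x \<le> i y"
          by (intro greatest) (simp add: algebra_simps)
        then show "i (x + y) \<le> i x + i y" by simp
      next
        fix r :: real and x assume r: "0 < r"
        have "i (r *\<^sub>R x) / r \<le> i x"
          using lower[of _ "r *\<^sub>R x"] sublinear_scale[OF sub, of _ r x] r
          by (intro greatest) (simp add: field_simps)
        then show "i (r *\<^sub>R x) \<le> r * i x"
          using r by (simp add: field_simps)
      next
        have "i 0 = (INF a\<in>C. 0)"
          unfolding i_def by (intro INF_cong refl) (simp add: sublinear_zero[OF sub])
        then show "i 0 = 0" using False by simp
      qed
      moreover have "i \<le> q"
      proof -
        obtain a where a: "a \<in> C" using False by blast
        then have "i \<le> a" using lower by (simp add: le_funI)
        also have "a \<le> q" using a CA by (auto simp: A_def)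
        finally show ?thesis .
      qed
      ultimately have "i \<in> A" by (simp add: A_def)
      then show ?thesis using lower by (auto simp: le_fun_def)
    qed
  qed
  then obtain m where m: "m \<in> A" "\<forall>a\<in>A. a \<le> m \<longrightarrow> a = m" ..
  have mq: "sublinear m" "m \<le> q"
    using m(1) by (auto simp: A_def)
  have "q' = m" if "sublinear q'" "q' \<le> m" for q'
  proof -
    have "q' \<in> A"
      using that(1) order_trans[OF that(2) mq(2)] by (simp add: A_def)
    with m(2) that(2) show ?thesis by blast
  qed
  with mq show ?thesis by blast
qed

text \<open>A minimal sublinear functional equals its own directional infima, which forces it to be odd.\<close>

lemma linear_below_sublinear:
  fixes q :: "'a::real_vector \<Rightarrow> real"
  assumes "sublinear q"
  shows "\<exists>u. linear u \<and> u \<le> q"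
proof -
  obtain m where m: "sublinear m" "m \<le> q" "\<And>q'. sublinear q' \<Longrightarrow> q' \<le> m \<Longrightarrow> q' = m"
    using minimal_sublinear_below[OF assms] by blast
  have "m (- z) \<le> - m z" for z
    using sublinear_directional_infimum[OF m(1), of z] m(3) by metis
  then have neg: "m (- z) = - m z" for z
    using sublinear_ge[OF m(1), of "- z"] by (simp add: order_antisym)
  have "linear m"
  proof (rule linearI)
    fix x y :: 'a
    \<comment> \<open>With oddness, subadditivity at \<open>x + y\<close> and \<open>- y\<close>
      becomes superadditivity.\<close>
    have "m (x + y + - y) \<le> m (x + y) + m (- y)"
      by (rule sublinear_add[OF m(1)])
    then have "m x + m y \<le> m (x + y)" by (simp add: neg)
    then show "m (x + y) = m x + m y"
      using sublinear_add[OF m(1), of x y] by simp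
  next
    fix r :: real and x :: 'a
    show "m (r *\<^sub>R x) = r *\<^sub>R m x"
      using sublinear_scale[OF m(1), of r x] sublinear_scale[OF m(1), of "- r" x] neg[of "r *\<^sub>R x"]
      by (cases "0 \<le> r") auto
  qed
  with m(2) show ?thesis by blast
qed

text \<open>Any linear \<open>u\<close> below a sublinear \<open>q \<le> norm\<close> with
  \<open>q (- z) \<le> - norm z\<close> satisfies
  \<open>u z = - u (- z) \<ge> norm z\<close>.\<close>

lemma real_norming_functional:
  fixes z :: "'a::real_normed_vector"
  obtains u :: "'a \<Rightarrow>\<^sub>L real" where "norm u \<le> 1" "u z = norm z"
proof -
  obtain q where q: "sublinear q" "q \<le> norm" "q (- z) \<le> - norm z"
    using sublinear_directional_infimum[OF sublinear_norm, of z] by blast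
  obtain u where u: "linear u" "u \<le> q"
    using linear_below_sublinear[OF q(1)] by blast
  have le: "u x \<le> norm x" for x
    using u(2) q(2) by (meson le_funD order_trans)
  have abs: "\<bar>u x\<bar> \<le> norm x" for x
    using le[of x] le[of "- x"] linear_neg[OF u(1), of x] by simp
  have bl: "bounded_linear u"
    using u(1) abs by (intro bounded_linear_intro[where K = 1]) (auto simp: linear_add linear_scale)
  have "u z = norm z"
    using le[of z] q(3) le_funD[OF u(2), of "- z"] linear_neg[OF u(1), of z] by simp
  moreover have "norm (Blinfun u) \<le> 1"
    using abs by (intro norm_blinfun_bound) (auto simp: bounded_linear_Blinfun_apply[OF bl])
  ultimately show ?thesis
    using that[of "Blinfun u"] by (simp add: bounded_linear_Blinfun_apply[OF bl])
qed

section \<open>Uniform boundedness\<close>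

text \<open>Baire's theorem in the real dual, which is complete even if \<open>'a\<close> is not:
  the functionals are covered by closed sets with bounded sums, and one of these contains a
  ball.\<close>

lemma weakly_absolutely_summable_bounded:
  fixes x :: "nat \<Rightarrow> 'a::real_normed_vector"
  assumes sum: "\<And>u :: 'a \<Rightarrow>\<^sub>L real. summable (\<lambda>i. \<bar>blinfun_apply u (x i)\<bar>)"
  shows "\<exists>H\<ge>0. \<forall>u :: 'a \<Rightarrow>\<^sub>L real. (\<Sum>i. \<bar>blinfun_apply u (x i)\<bar>) \<le> H * norm u"
proof -
  \<comment> \<open>Bounding each partial sum instead of the whole series makes \<open>E n\<close>
    an intersection of closed sets.\<close>
  define E where "E n = {u :: 'a \<Rightarrow>\<^sub>L real. \<forall>m. (\<Sum>i<m. \<bar>blinfun_apply u (x i)\<bar>) \<le> real n}" for n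
  have closed: "closed (E n)" for n
    unfolding E_def by (intro closed_Collect_all closed_Collect_le continuous_intros)
  have "u \<in> (\<Union>n. E n)" for u
  proof -
    obtain n where n: "(\<Sum>i. \<bar>blinfun_apply u (x i)\<bar>) \<le> real n"
      using real_arch_simple by blast
    have "(\<Sum>i<m. \<bar>blinfun_apply u (x i)\<bar>) \<le> real n" for m
      using sum_le_suminf[OF sum[of u], of "{..<m}"] n by auto
    then show ?thesis by (auto simp: E_def)
  qed
  then have "(\<Union>n. E n) = UNIV" by blast
  moreover have "interior (\<Union>n. E n) = {}" if "\<And>n. interior (E n) = {}"
    using Met_TC.metric_Baire_category_alt[of "range E"] closed that
    by (auto simp: complete_UNIV)
  ultimately obtain n where "interior (E n) \<noteq> {}" by fastforce
  then obtain u0 e where e: "0 < e" and ball: "cball u0 e \<subseteq> E n"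
    by (meson all_not_in_conv mem_interior_cball)
  have "(\<Sum>i<m. \<bar>blinfun_apply u (x i)\<bar>) \<le> (2 * n / e) * norm u" for u :: "'a \<Rightarrow>\<^sub>L real" and m
  proof (cases "u = 0")
    case False
    \<comment> \<open>Rescaling \<open>u\<close> to norm \<open>e\<close> keeps
      \<open>u0 + v\<close> in the ball; since \<open>v = (u0 + v) - u0\<close>, its partial sums
      are at most \<open>n + n\<close>.\<close>
    define v where "v = (e / norm u) *\<^sub>R u"
    have v: "u0 + v \<in> E n" "u0 \<in> E n"
      using ball e False by (auto simp: v_def dist_norm subset_iff)
    have "(e / norm u) * (\<Sum>i<m. \<bar>blinfun_apply u (x i)\<bar>) = (\<Sum>i<m. \<bar>blinfun_apply v (x i)\<bar>)"
      using e by (simp add: v_def sum_distrib_left abs_mult scaleR_blinfun.rep_eq)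
    also have "\<dots> \<le> (\<Sum>i<m. \<bar>blinfun_apply (u0 + v) (x i)\<bar> + \<bar>blinfun_apply u0 (x i)\<bar>)"
      by (intro sum_mono) (simp add: plus_blinfun.rep_eq)
    also have "\<dots> \<le> 2 * n"
      using v by (auto simp: E_def sum.distrib dest!: spec[of _ m])
    finally show ?thesis
      using e False by (simp add: field_simps)
  qed simp
  then have "(\<Sum>i. \<bar>blinfun_apply u (x i)\<bar>) \<le> (2 * n / e) * norm u" for u :: "'a \<Rightarrow>\<^sub>L real"
    using sum by (intro suminf_le_const) auto
  moreover have "0 \<le> 2 * n / e" using e by simp
  ultimately show ?thesis by blast
qed

section \<open>Arithmetic means\<close>

lemma arithmetic_mean_tendsto:
  fixes d :: "nat \<Rightarrow> real"
  assumes "d \<longlonglongrightarrow> l"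
  shows "(\<lambda>n. (1 / real n) * (\<Sum>k<n. d k)) \<longlonglongrightarrow> l"
proof (rule LIMSEQ_I)
  fix e :: real assume e: "0 < e"
  obtain N where N: "\<And>k. k \<ge> N \<Longrightarrow> \<bar>d k - l\<bar> < e / 2"
    using LIMSEQ_D[OF assms, of "e / 2"] e by auto
  define M where "M = (\<Sum>k<N. \<bar>d k - l\<bar>)"
  obtain N' where N': "2 * M / e < real N'"
    using reals_Archimedean2 by blast
  \<comment> \<open>\<open>Suc N\<close> makes \<open>n\<close> positive, and \<open>N'\<close>
    makes the fixed head \<open>M\<close> smaller than \<open>n * (e / 2)\<close>.\<close>
  have "norm ((1 / real n) * (\<Sum>k<n. d k) - l) < e" if n: "n \<ge> max (Suc N) N'" for n
  proof -
    have "(\<Sum>k<n. d k) - n * l = (\<Sum>k<n. d k - l)"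
      by (simp add: sum_subtractf)
    also have "\<bar>\<dots>\<bar> \<le> (\<Sum>k<n. \<bar>d k - l\<bar>)" by (rule sum_abs)
    also have "\<dots> = M + (\<Sum>k\<in>{N..<n}. \<bar>d k - l\<bar>)"
      using n sum.atLeastLessThan_concat[of 0 N n "\<lambda>k. \<bar>d k - l\<bar>"]
      by (simp add: M_def atLeast0LessThan)
    also have "(\<Sum>k\<in>{N..<n}. \<bar>d k - l\<bar>) \<le> (\<Sum>k\<in>{N..<n}. e / 2)"
      using N by (intro sum_mono less_imp_le) auto
    also have "\<dots> \<le> n * (e / 2)" using e by (simp add: mult_right_mono)
    also have "M < n * (e / 2)"
    proof -
      have "2 * M / e < real n" using N' n by simp
      then show ?thesis using e by (simp add: field_simps)
    qed
    finally have "\<bar>(\<Sum>k<n. d k) - n * l\<bar> < n * e" by (simp add: mult.commute)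
    moreover have "(1 / real n) * (\<Sum>k<n. d k) - l = ((\<Sum>k<n. d k) - n * l) / n"
      using n by (simp add: field_simps)
    ultimately show ?thesis
      using n by (simp add: abs_divide divide_less_eq mult.commute)
  qed
  then show "\<exists>no. \<forall>n\<ge>no. norm ((1 / real n) * (\<Sum>k<n. d k) - l) < e" by blast
qed

text \<open>Although \<open>d\<close> may diverge, its minorant \<open>min c (d k)\<close> is
  eventually \<open>c\<close>, so the means of the minorant tend to \<open>c > 0\<close>.\<close>

lemma arithmetic_mean_null_not_bounded_below:
  fixes d :: "nat \<Rightarrow> real"
  assumes null: "(\<lambda>n. (1 / real n) * (\<Sum>k<n. d k)) \<longlonglongrightarrow> 0"
    and c: "0 < c"
  shows "\<not> (\<forall>\<^sub>F k in sequentially. c \<le> d k)"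
proof
  assume "\<forall>\<^sub>F k in sequentially. c \<le> d k"
  then have "\<forall>\<^sub>F k in sequentially. min c (d k) = c"
    by eventually_elim simp
  then have "(\<lambda>k. min c (d k)) \<longlonglongrightarrow> c"
    by (rule tendsto_eventually)
  then have "(\<lambda>n. (1 / real n) * (\<Sum>k<n. min c (d k))) \<longlonglongrightarrow> c"
    by (rule arithmetic_mean_tendsto)
  then have "c \<le> 0"
    using null by (rule LIMSEQ_le) (auto intro!: exI[of _ 0] divide_right_mono sum_mono)
  with c show False by simp
qed

text \<open>The means inherit the limit \<open>norm (l - l') powr p\<close>, which vanishes only for
  \<open>l = l'\<close>. Positivity of \<open>p\<close> gives continuity of the power at base
  0.\<close>

lemma arithmetic_mean_powr_null_iff:
  fixes s :: "nat \<Rightarrow> 'b::real_normed_vector"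
  assumes s: "s \<longlonglongrightarrow> l" and p: "0 < p"
  shows "(\<lambda>n. (1 / real n) * (\<Sum>k<n. norm (s k - l') powr p)) \<longlonglongrightarrow> 0 \<longleftrightarrow> l = l'"
proof -
  have "(\<lambda>k. norm (s k - l') powr p) \<longlonglongrightarrow> norm (l - l') powr p"
    using p by (intro tendsto_powr' tendsto_intros s) auto
  then have lim: "(\<lambda>n. (1 / real n) * (\<Sum>k<n. norm (s k - l') powr p)) \<longlonglongrightarrow> norm (l - l') powr p"
    by (rule arithmetic_mean_tendsto)
  show ?thesis
    using lim LIMSEQ_unique[OF lim, of 0] by auto
qed

section \<open>Bounded sequences\<close>

lemma summable_bcontfun_mult:
  fixes a :: "nat \<Rightarrow>\<^sub>C 'k::{real_normed_field, banach}"
  assumes "summable (\<lambda>i. norm (g i))"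
  shows "summable (\<lambda>i. a i * g i)"
proof (rule summable_comparison_test')
  show "summable (\<lambda>i. norm a * norm (g i))"
    using assms by (rule summable_mult)
  show "norm (a i * g i) \<le> norm a * norm (g i)" if "i \<ge> 0" for i
    by (simp add: norm_mult mult_right_mono norm_bounded)
qed

lemma suminf_bcontfun_mult_diff_le:
  fixes a b :: "nat \<Rightarrow>\<^sub>C 'k::{real_normed_field, banach}"
  assumes g: "summable (\<lambda>i. norm (g i))"
  shows "norm ((\<Sum>i. a i * g i) - (\<Sum>i. b i * g i)) \<le> dist a b * (\<Sum>i. norm (g i))"
proof -
  have "(\<Sum>i. a i * g i) - (\<Sum>i. b i * g i) = (\<Sum>i. a i * g i - b i * g i)"
    by (intro suminf_diff summable_bcontfun_mult g)
  also have "norm \<dots> \<le> (\<Sum>i. dist a b * norm (g i))"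
    by (intro norm_suminf_le summable_mult g)
      (simp add: norm_mult mult_right_mono dist_bounded flip: dist_norm left_diff_distrib)
  also have "\<dots> = dist a b * (\<Sum>i. norm (g i))"
    by (rule suminf_mult[OF g])
  finally show ?thesis .
qed

text \<open>The library makes \<open>'a \<Rightarrow>\<^sub>C 'b\<close> a complete space only for metric \<open>'a\<close>, and \<open>nat\<close> is not an instance.\<close>

lemma complete_bcontfun_iff_closed:
  fixes S :: "('a::topological_space \<Rightarrow>\<^sub>C 'b::complete_space) set"
  shows "complete S \<longleftrightarrow> closed S"
proof
  have "complete (UNIV :: ('a \<Rightarrow>\<^sub>C 'b) set)"
  proof (rule completeI)
    fix a :: "nat \<Rightarrow> 'a \<Rightarrow>\<^sub>C 'b" assume "Cauchy a"
    then have "uniformly_convergent_on UNIV (\<lambda>n. apply_bcontfun (a n))"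
      unfolding uniformly_convergent_eq_Cauchy Cauchy_def uniformly_Cauchy_on_def
      by (meson dist_fun_lt_imp_dist_val_lt)
    then obtain g where "uniform_limit UNIV (\<lambda>n. apply_bcontfun (a n)) g sequentially"
      by (auto simp: uniformly_convergent_on_def)
    then show "\<exists>l\<in>UNIV. a \<longlonglongrightarrow> l"
      by (rule uniform_limit_bcontfunE[OF _ sequentially_bot]) auto
  qed
  then show "closed S \<Longrightarrow> complete S"
    by (rule complete_closed_subset[rotated 2]) auto
qed (rule complete_imp_closed)

lemma null_sequence_limit_of_truncations:
  fixes a :: "nat \<Rightarrow>\<^sub>C 'k::real_normed_vector"
  assumes "a \<in> null_sequences"
  obtains b :: "nat \<Rightarrow> nat \<Rightarrow>\<^sub>C 'k" where "\<And>N i. i \<ge> N \<Longrightarrow> b N i = 0" "b \<longlonglongrightarrow> a"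
proof -
  define b :: "nat \<Rightarrow> nat \<Rightarrow>\<^sub>C 'k" where "b N = Bcontfun (\<lambda>i. if i < N then a i else 0)" for N
  have "(\<lambda>i. if i < N then a i else 0) \<in> bcontfun" for N
    by (intro bcontfun_normI[where b = "norm a"]) (auto simp: norm_bounded)
  then have b: "apply_bcontfun (b N) i = (if i < N then a i else 0)" for N i
    by (simp add: b_def Bcontfun_inverse)
  have "b \<longlonglongrightarrow> a"
  proof (rule metric_LIMSEQ_I)
    fix e :: real assume e: "0 < e"
    obtain M where M: "\<And>i. i \<ge> M \<Longrightarrow> norm (a i) < e / 2"
      using LIMSEQ_D[of a 0 "e / 2"] assms e by (auto simp: null_sequences_def)
    have "dist (b N) a < e" if "N \<ge> M" for N
    proof -
      \<comment> \<open>A supremum inherits only a non-strict bound, hence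
        \<open>e / 2\<close>.\<close>
      have "dist (b N) a \<le> e / 2"
        using that e M by (intro dist_bound) (auto simp: b intro: less_imp_le)
      with e show ?thesis by simp
    qed
    then show "\<exists>M. \<forall>N\<ge>M. dist (b N) a < e" by blast
  qed
  with b show ?thesis by (intro that) auto
qed

section \<open>Functionals over the scalar field\<close>

context normed_space_over
begin

lemma dual_spaceD:
  assumes "f \<in> dual_space sc"
  shows "bounded_linear f" "f (sc c y) = c * f y"
proof -
  have lin: "Vector_Spaces.linear sc (*) f" and "\<exists>K. \<forall>x. norm (f x) \<le> K * norm x"
    using assms by (auto simp: dual_space_def)
  then obtain K where K: "\<And>x. norm (f x) \<le> K * norm x" by blast
  interpret f: Vector_Spaces.linear sc "(*)" f by (rule lin)
  show "f (sc c y) = c * f y" by (rule f.scale)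
  show "bounded_linear f"
  proof (rule bounded_linear_intro)
    show "f (r *\<^sub>R x) = r *\<^sub>R f x" for r x
      using f.scale[of "of_real r" x] by (simp add: scale_of_real scaleR_conv_of_real)
    show "norm (f x) \<le> norm x * K" for x using K[of x] by (simp add: mult.commute)
  qed (rule f.add)
qed

lemma dual_space_sum:
  "f \<in> dual_space sc \<Longrightarrow> f (\<Sum>i\<in>I. sc (a i) (x i)) = (\<Sum>i\<in>I. a i * f (x i))"
  by (simp add: dual_spaceD(2) linear_sum[OF bounded_linear.linear[OF dual_spaceD(1)]])

text \<open>
  The form \<open>1 \<bullet> (c * d)\<close> on \<open>'k\<close> is nondegenerate, as \<open>d = inverse c\<close> shows. Hence \<open>f y\<close> can be
  defined as the scalar that represents the real functional \<open>d \<mapsto> u (sc d y)\<close>; this plays the role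
  of \<open>f y = u y - \<i> * u (\<i> * y)\<close> and needs no classification of the field \<open>'k\<close>.
\<close>

lemma dual_of_real_functional:
  fixes u :: "'a \<Rightarrow>\<^sub>L real"
  obtains f where "f \<in> dual_space sc" "\<And>y. 1 \<bullet> f y = u y" "\<And>y. norm (f y) \<le> norm u * norm y"
proof -
  have inner1: "(1::'k) \<bullet> 1 = 1" by (simp flip: norm_eq_1)
  \<comment> \<open>\<open>T c\<close> represents \<open>d \<mapsto> 1 \<bullet> (c * d)\<close> in
    the inner product. Nondegeneracy makes \<open>T\<close> injective, hence surjective in finite
    dimension, so every real functional on \<open>'k\<close> has this form.\<close>
  define T :: "'k \<Rightarrow> 'k" where "T c = (\<Sum>b\<in>Basis. (1 \<bullet> (c * b)) *\<^sub>R b)" for c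
  have T: "T c \<bullet> d = 1 \<bullet> (c * d)" for c d
  proof -
    have "1 \<bullet> (c * d) = 1 \<bullet> (c * (\<Sum>b\<in>Basis. (d \<bullet> b) *\<^sub>R b))"
      by (simp add: euclidean_representation)
    also have "\<dots> = (\<Sum>b\<in>Basis. (d \<bullet> b) * (1 \<bullet> (c * b)))"
      by (simp add: sum_distrib_left inner_sum_right)
    also have "\<dots> = T c \<bullet> d"
      by (simp add: T_def inner_sum_left inner_commute[of d] mult.commute)
    finally show ?thesis ..
  qed
  have nondeg: "c = 0" if "\<And>d. 1 \<bullet> (c * d) = 0" for c :: 'k
    using that[of "inverse c"] inner1 by (cases "c = 0") auto
  have linT: "linear T"
    by (rule linearI) (auto simp: T_def algebra_simps inner_add_right sum.distrib scaleR_sum_right)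
  have "inj T"
    unfolding linear_injective_0[OF linT] using T nondeg by (metis inner_zero_left)
  then have "surj T" by (rule linear_inj_imp_surj[OF linT])
  have "\<exists>c. \<forall>d. 1 \<bullet> (c * d) = u (sc d y)" for y
  proof -
    obtain c where c: "T c = (\<Sum>b\<in>Basis. u (sc b y) *\<^sub>R b)"
      using \<open>surj T\<close> by (metis surjD)
    have "1 \<bullet> (c * d) = u (sc d y)" for d
    proof -
      have "1 \<bullet> (c * d) = (\<Sum>b\<in>Basis. u (sc b y) *\<^sub>R b) \<bullet> d"
        using T[of c d] c by simp
      also have "\<dots> = (\<Sum>b\<in>Basis. (d \<bullet> b) * u (sc b y))"
        by (simp add: inner_sum_left inner_commute[of d] mult.commute)
      also have "\<dots> = u (\<Sum>b\<in>Basis. sc (of_real (d \<bullet> b) * b) y)"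
        by (simp add: blinfun.sum_right blinfun.scaleR_right scale_of_real flip: scale_scale)
      also have "\<dots> = u (sc (\<Sum>b\<in>Basis. (d \<bullet> b) *\<^sub>R b) y)"
        by (simp add: scale_sum_left scaleR_conv_of_real)
      also have "\<dots> = u (sc d y)" by (simp add: euclidean_representation)
      finally show ?thesis .
    qed
    then show ?thesis by blast
  qed
  then obtain f where f: "\<And>y d. 1 \<bullet> (f y * d) = u (sc d y)" by metis
  have eqI: "c = c'" if "\<And>d. 1 \<bullet> (c * d) = 1 \<bullet> (c' * d)" for c c' :: 'k
    using nondeg[of "c - c'"] that by (simp add: left_diff_distrib inner_diff_right)
  have add: "f (y + z) = f y + f z" for y z
    by (rule eqI) (simp add: f ring_distribs inner_add_right scale_right_distrib blinfun.add_right)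
  have scale: "f (sc c y) = c * f y" for c y
  proof (rule eqI)
    fix d
    have "1 \<bullet> (f (sc c y) * d) = 1 \<bullet> (f y * (d * c))" by (simp add: f)
    then show "1 \<bullet> (f (sc c y) * d) = 1 \<bullet> (c * f y * d)" by (simp add: mult_ac)
  qed
  have bound: "norm (f y) \<le> norm u * norm y" for y
  proof (cases "f y = 0")
    case False
    \<comment> \<open>The choice \<open>d = inverse (f y)\<close> turns the defining identity into
      \<open>1 \<bullet> 1 = 1\<close>.\<close>
    have "1 = u (sc (inverse (f y)) y)"
      using f[of y "inverse (f y)"] False inner1 by simp
    also have "\<dots> \<le> norm u * norm (sc (inverse (f y)) y)"
      using norm_blinfun[of u "sc (inverse (f y)) y"] by simp
    also have "\<dots> = norm u * norm y / norm (f y)"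
      by (simp add: norm_scale norm_inverse divide_inverse)
    finally show ?thesis using False by (simp add: field_simps)
  qed simp
  have "Vector_Spaces.linear sc (*) f"
    by unfold_locales (auto simp: add scale algebra_simps)
  then have "f \<in> dual_space sc"
    using bound by (auto simp: dual_space_def)
  moreover have "1 \<bullet> f y = u y" for y
    using f[of y 1] by simp
  ultimately show ?thesis using bound that by blast
qed

text \<open>The scalar functional \<open>f\<close> built from a real norming \<open>u\<close> has
  \<open>1 \<bullet> f z = norm z\<close>, so Cauchy-Schwarz with \<open>norm 1 = 1\<close> gives
  \<open>norm z \<le> norm (f z)\<close>.\<close>

lemma norming_functional:
  obtains f where "f \<in> dual_space sc" "\<And>y. norm (f y) \<le> norm y" "norm (f z) = norm z"
proof -
  obtain u :: "'a \<Rightarrow>\<^sub>L real" where u: "norm u \<le> 1" "u z = norm z"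
    by (rule real_norming_functional)
  obtain f where f: "f \<in> dual_space sc" "\<And>y. 1 \<bullet> f y = u y" "\<And>y. norm (f y) \<le> norm u * norm y"
    using dual_of_real_functional[of u] by blast
  have le: "norm (f y) \<le> norm y" for y
    using f(3)[of y] mult_right_mono[OF u(1), of "norm y"] by simp
  have "norm z \<le> norm (f z)"
    using norm_cauchy_schwarz[of 1 "f z"] f(2)[of z] u(2) by simp
  with le[of z] have "norm (f z) = norm z" by simp
  with f(1) le show ?thesis by (rule that)
qed

text \<open>Reduction to real functionals in both directions: each real \<open>u\<close> is
  dominated by a scalar \<open>f\<close>, and the coordinates of a scalar \<open>f\<close> are real
  functionals of norm at most 1. The bound is \<open>H\<close> once per basis vector of
  \<open>'k\<close>.\<close>

lemma weakly_unconditionally_Cauchy_bounded: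
  assumes wuc: "weakly_unconditionally_Cauchy sc x"
  obtains H where "\<And>f. f \<in> dual_space sc \<Longrightarrow> (\<And>y. norm (f y) \<le> norm y) \<Longrightarrow> (\<Sum>i. norm (f (x i))) \<le> H"
proof -
  have sum: "summable (\<lambda>i. \<bar>blinfun_apply u (x i)\<bar>)" for u :: "'a \<Rightarrow>\<^sub>L real"
  proof -
    obtain f where f: "f \<in> dual_space sc" "\<And>y. 1 \<bullet> f y = u y"
      using dual_of_real_functional[of u] by metis
    have "summable (\<lambda>i. norm (f (x i)))"
      using wuc f(1) by (auto simp: weakly_unconditionally_Cauchy_def)
    then show ?thesis
      using Cauchy_Schwarz_ineq2[of 1 "f (x _)"] f(2)
      by (elim summable_comparison_test'[where N = 0]) simp
  qed
  obtain H where H: "0 \<le> H" "\<And>u :: 'a \<Rightarrow>\<^sub>L real. (\<Sum>i. \<bar>blinfun_apply u (x i)\<bar>) \<le> H * norm u"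
    using weakly_absolutely_summable_bounded[OF sum] by blast
  have "(\<Sum>i. norm (f (x i))) \<le> (\<Sum>b\<in>(Basis :: 'k set). H)"
    if f: "f \<in> dual_space sc" and le: "\<And>y. norm (f y) \<le> norm y" for f
  proof -
    define u where "u b = Blinfun (\<lambda>y. f y \<bullet> b)" for b
    have "bounded_linear (\<lambda>y. f y \<bullet> b)" for b
      by (rule bounded_linear_compose[OF bounded_linear_inner_left dual_spaceD(1)[OF f]])
    then have u: "u b y = f y \<bullet> b" for b y
      by (simp add: u_def bounded_linear_Blinfun_apply)
    have "norm (u b) \<le> 1" if b: "b \<in> Basis" for b
      using Basis_le_norm[OF b] le by (intro norm_blinfun_bound) (auto simp: u intro: order_trans)
    then have uH: "(\<Sum>i. \<bar>blinfun_apply (u b) (x i)\<bar>) \<le> H" if "b \<in> Basis" for b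
      using H(2)[of "u b"] mult_left_mono[of "norm (u b)" 1 H] H(1) that by fastforce
    have "(\<Sum>i. norm (f (x i))) \<le> (\<Sum>i. \<Sum>b\<in>Basis. \<bar>blinfun_apply (u b) (x i)\<bar>)"
      using wuc f
      by (intro suminf_le summable_sum sum) (auto simp: u norm_le_l1 weakly_unconditionally_Cauchy_def)
    also have "\<dots> = (\<Sum>b\<in>Basis. \<Sum>i. \<bar>blinfun_apply (u b) (x i)\<bar>)"
      by (intro suminf_sum sum)
    also have "\<dots> \<le> (\<Sum>b\<in>(Basis :: 'k set). H)"
      by (intro sum_mono uH)
    finally show ?thesis .
  qed
  then show ?thesis by (rule that)
qed

section \<open>The summability space\<close>

lemma mem_summability_space_iff:
  assumes wuc: "weakly_unconditionally_Cauchy sc x" and p: "0 < p"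
  shows "a \<in> summability_space sc p x \<longleftrightarrow> (\<exists>L. \<forall>f\<in>dual_space sc. (\<Sum>i. a i * f (x i)) = f L)"
proof -
  have "(\<lambda>n. (1 / real n) * (\<Sum>k<n. norm (f (\<Sum>i\<le>k. sc (a i) (x i)) - f L) powr p)) \<longlonglongrightarrow> 0 \<longleftrightarrow>
      (\<Sum>i. a i * f (x i)) = f L" if f: "f \<in> dual_space sc" for f L
  proof (rule arithmetic_mean_powr_null_iff[OF _ p])
    have "summable (\<lambda>i. a i * f (x i))"
      using wuc f by (intro summable_bcontfun_mult) (auto simp: weakly_unconditionally_Cauchy_def)
    then show "(\<lambda>k. f (\<Sum>i\<le>k. sc (a i) (x i))) \<longlonglongrightarrow> (\<Sum>i. a i * f (x i))"
      by (simp add: dual_space_sum[OF f] summable_LIMSEQ')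
  qed
  then show ?thesis
    unfolding summability_space_def weak_wp_summable_series_def weak_wp_summable_def
      weak_wp_summable_to_def by simp
qed

lemma finite_support_in_summability_space:
  assumes p: "0 < p" and a: "\<And>i. i \<ge> N \<Longrightarrow> apply_bcontfun a i = 0"
  shows "a \<in> summability_space sc p x"
proof -
  define L where "L = (\<Sum>i\<le>N. sc (a i) (x i))"
  have const: "(\<Sum>i\<le>k. sc (a i) (x i)) = L" if "k \<ge> N" for k
    unfolding L_def using that a by (intro sum.mono_neutral_right) auto
  have "(\<lambda>n. (1 / real n) * (\<Sum>k<n. norm (f (\<Sum>i\<le>k. sc (a i) (x i)) - f L) powr p)) \<longlonglongrightarrow> 0"
    for f :: "'a \<Rightarrow> 'k"
  proof -
    have "(\<lambda>k. f (\<Sum>i\<le>k. sc (a i) (x i))) \<longlonglongrightarrow> f L"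
      by (rule tendsto_eventually, rule eventually_sequentiallyI[of N]) (simp add: const)
    then show ?thesis
      by (simp only: arithmetic_mean_powr_null_iff[OF _ p])
  qed
  then show ?thesis
    unfolding summability_space_def weak_wp_summable_series_def weak_wp_summable_def
      weak_wp_summable_to_def by blast
qed

lemma null_sequences_subset_summability_space:
  assumes p: "0 < p" and closed: "closed (summability_space sc p x)"
  shows "null_sequences \<subseteq> summability_space sc p x"
proof
  fix a :: "nat \<Rightarrow>\<^sub>C 'k" assume "a \<in> null_sequences"
  then obtain b where b: "\<And>N i. i \<ge> N \<Longrightarrow> apply_bcontfun (b N) i = 0" "b \<longlonglongrightarrow> a"
    using null_sequence_limit_of_truncations by blast
  have "b N \<in> summability_space sc p x" for N
    using p b(1)[of N] by (rule finite_support_in_summability_space)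
  with b(2) closed show "a \<in> summability_space sc p x"
    by (meson closed_sequentially)
qed

lemma weakly_unconditionally_Cauchy_if_null_sequences_subset:
  assumes sub: "null_sequences \<subseteq> summability_space sc p x" and p: "0 < p"
  shows "weakly_unconditionally_Cauchy sc x"
proof (rule ccontr)
  assume "\<not> weakly_unconditionally_Cauchy sc x"
  then obtain f where f: "f \<in> dual_space sc" and div: "\<not> summable (\<lambda>i. norm (f (x i)))"
    by (auto simp: weakly_unconditionally_Cauchy_def)
  define S where "S k = (\<Sum>i\<le>k. norm (f (x i)))" for k
  have S0: "0 \<le> S k" for k by (simp add: S_def sum_nonneg)
  have Smono: "S i \<le> S k" if "i \<le> k" for i k
    unfolding S_def using that by (intro sum_mono2) auto
  have unbounded: "\<exists>k. Z \<le> S k" for Z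
  proof (rule ccontr)
    assume "\<nexists>k. Z \<le> S k"
    then have "(\<Sum>i<n. norm (f (x i))) \<le> Z" for n
      using sum_mono2[of "{..n}" "{..<n}" "\<lambda>i. norm (f (x i))"]
      by (auto simp: S_def not_le intro: order_trans less_imp_le)
    then show False
      using div summableI_nonneg_bounded[of "\<lambda>i. norm (f (x i))" Z] by simp
  qed
  have S: "filterlim S at_top sequentially"
    unfolding filterlim_at_top eventually_sequentially
    using unbounded Smono by (meson order_trans)
  \<comment> \<open>The summand 1 keeps \<open>w\<close> at least 1, so division by \<open>w\<close>
    is safe.\<close>
  define w where "w k = sqrt (1 + S k)" for k
  have w: "filterlim w at_top sequentially"
    unfolding w_def
    by (intro filterlim_compose[OF sqrt_at_top] filterlim_tendsto_add_at_top[OF tendsto_const] S)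
  have w1: "1 \<le> w k" for k using S0[of k] by (simp add: w_def)
  have wmono: "w i \<le> w k" if "i \<le> k" for i k using Smono[OF that] by (simp add: w_def)
  \<comment> \<open>Chosen so that \<open>c i * f (x i) = norm (f (x i)) / w i\<close>. For
    \<open>f (x i) = 0\<close>, division by zero gives \<open>c i = 0\<close> and the identity
    persists.\<close>
  define c where "c i = of_real (norm (f (x i)) / w i) / f (x i)" for i
  have normc: "norm (c i) \<le> inverse (w i)" for i
    using w1[of i] by (cases "f (x i) = 0") (simp_all add: c_def norm_divide field_simps del: of_real_divide)
  have "c \<in> bcontfun"
  proof (rule bcontfun_normI)
    show "norm (c i) \<le> 1" for i
      using normc[of i] w1[of i] by (meson inverse_le_1_iff order_trans)
  qed simp
  then have c: "apply_bcontfun (Bcontfun c) = c"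
    by (rule Bcontfun_inverse)
  have "c \<longlonglongrightarrow> 0"
    using always_eventually[OF allI[OF normc]] tendsto_inverse_0_at_top[OF w]
    by (rule Lim_null_comparison)
  then have "Bcontfun c \<in> null_sequences"
    by (simp add: null_sequences_def c)
  with sub have "Bcontfun c \<in> summability_space sc p x" by blast
  then obtain L where L: "(\<lambda>n. (1 / real n) *
      (\<Sum>k<n. norm (f (\<Sum>i\<le>k. sc (c i) (x i)) - f L) powr p)) \<longlonglongrightarrow> 0"
    using f unfolding summability_space_def weak_wp_summable_series_def
      weak_wp_summable_def weak_wp_summable_to_def c mem_Collect_eq by blast
  have large: "w k - 1 \<le> norm (f (\<Sum>i\<le>k. sc (c i) (x i)))" for k
  proof -
    \<comment> \<open>As \<open>w\<close> is increasing, the weighted sum is at least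
      \<open>S k / w k\<close>, and \<open>S k = w k * w k - 1\<close>.\<close>
    have "w k * (w k - 1) \<le> w k * w k - 1"
      using w1[of k] by (simp add: algebra_simps)
    also have "\<dots> = S k"
      using S0[of k] by (simp add: w_def)
    finally have "w k - 1 \<le> S k / w k"
      using w1[of k] by (simp add: field_simps)
    also have "\<dots> = (\<Sum>i\<le>k. norm (f (x i)) / w k)"
      by (simp add: S_def sum_divide_distrib)
    also have "\<dots> \<le> (\<Sum>i\<le>k. norm (f (x i)) / w i)"
      using wmono w1 by (intro sum_mono divide_left_mono mult_pos_pos) (auto intro: less_le_trans[OF zero_less_one])
    also have "\<dots> \<le> norm (of_real (\<Sum>i\<le>k. norm (f (x i)) / w i) :: 'k)"
      unfolding norm_of_real by (rule abs_ge_self)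
    also have "of_real (\<Sum>i\<le>k. norm (f (x i)) / w i) = f (\<Sum>i\<le>k. sc (c i) (x i))"
      unfolding dual_space_sum[OF f] of_real_sum by (intro sum.cong) (auto simp: c_def)
    finally show ?thesis .
  qed
  have "\<forall>\<^sub>F k in sequentially. 1 \<le> norm (f (\<Sum>i\<le>k. sc (c i) (x i)) - f L) powr p"
    \<comment> \<open>The threshold leaves at least 1 after \<open>large\<close> costs 1 and the
      triangle inequality costs \<open>norm (f L)\<close>.\<close>
    using filterlim_at_top[THEN iffD1, OF w, rule_format, of "2 + norm (f L)"]
  proof eventually_elim
    case (elim k)
    then have "1 \<le> norm (f (\<Sum>i\<le>k. sc (c i) (x i)) - f L)"
      using large[of k] norm_triangle_ineq2[of "f (\<Sum>i\<le>k. sc (c i) (x i))" "f L"] by simp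
    then show ?case using p by (intro ge_one_powr_ge_zero) auto
  qed
  then show False
    using arithmetic_mean_null_not_bounded_below[OF L] by simp
qed

end

text \<open>The values \<open>L n\<close> of the approximating series form a Cauchy sequence by the
  Lipschitz estimate \<open>L_dist\<close>; completeness of \<open>'a\<close> supplies the value
  \<open>L'\<close> of the limiting series.\<close>

lemma closed_summability_space:
  fixes sc :: "'k::{real_normed_field, euclidean_space} \<Rightarrow> 'a::banach \<Rightarrow> 'a"
  assumes "normed_space_over sc" and wuc: "weakly_unconditionally_Cauchy sc x" and p: "0 < p"
  shows "closed (summability_space sc p x)"
  unfolding closed_sequential_limits
proof (intro allI impI, elim conjE)
  interpret normed_space_over sc by fact
  fix a :: "nat \<Rightarrow> nat \<Rightarrow>\<^sub>C 'k" and a'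
  assume a: "\<forall>n. a n \<in> summability_space sc p x" and lim: "a \<longlonglongrightarrow> a'"
  have sum: "summable (\<lambda>i. norm (f (x i)))" if "f \<in> dual_space sc" for f
    using wuc that by (auto simp: weakly_unconditionally_Cauchy_def)
  obtain H where H: "\<And>f. f \<in> dual_space sc \<Longrightarrow> (\<And>y. norm (f y) \<le> norm y) \<Longrightarrow> (\<Sum>i. norm (f (x i))) \<le> H"
    using weakly_unconditionally_Cauchy_bounded[OF wuc] by blast
  obtain L where L: "\<And>n f. f \<in> dual_space sc \<Longrightarrow> (\<Sum>i. a n i * f (x i)) = f (L n)"
    using a unfolding mem_summability_space_iff[OF wuc p] by metis
  \<comment> \<open>\<open>1 + \<bar>H\<bar>\<close> replaces \<open>H\<close> to have a positive
    constant to divide \<open>e\<close> by.\<close>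
  have L_dist: "dist (L m) (L n) \<le> dist (a m) (a n) * (1 + \<bar>H\<bar>)" for m n
  proof -
    obtain f where f: "f \<in> dual_space sc" "\<And>y. norm (f y) \<le> norm y" "norm (f (L m - L n)) = norm (L m - L n)"
      using norming_functional[of "L m - L n"] by blast
    have "dist (L m) (L n) = norm ((\<Sum>i. a m i * f (x i)) - (\<Sum>i. a n i * f (x i)))"
      using f(3) by (simp add: L[OF f(1)] dist_norm linear_diff[OF bounded_linear.linear[OF dual_spaceD(1)[OF f(1)]]])
    also have "\<dots> \<le> dist (a m) (a n) * (\<Sum>i. norm (f (x i)))"
      by (rule suminf_bcontfun_mult_diff_le[OF sum[OF f(1)]])
    also have "\<dots> \<le> dist (a m) (a n) * (1 + \<bar>H\<bar>)"
      using H[OF f(1,2)] by (intro mult_left_mono) auto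
    finally show ?thesis .
  qed
  have "Cauchy L"
  proof (rule metric_CauchyI)
    fix e :: real assume e: "0 < e"
    obtain M where M: "\<And>m n. m \<ge> M \<Longrightarrow> n \<ge> M \<Longrightarrow> dist (a m) (a n) < e / (1 + \<bar>H\<bar>)"
      using metric_CauchyD[OF LIMSEQ_imp_Cauchy[OF lim], of "e / (1 + \<bar>H\<bar>)"] e by auto
    have "dist (L m) (L n) < e" if "m \<ge> M" "n \<ge> M" for m n
    proof -
      have "dist (a m) (a n) * (1 + \<bar>H\<bar>) < e"
        using M[OF that] by (simp add: pos_less_divide_eq)
      with L_dist[of m n] show ?thesis by simp
    qed
    then show "\<exists>M. \<forall>m\<ge>M. \<forall>n\<ge>M. dist (L m) (L n) < e" by blast
  qed
  then obtain L' where L': "L \<longlonglongrightarrow> L'"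
    using Cauchy_convergent convergent_def by blast
  \<comment> \<open>Both sides are limits of \<open>f (L n)\<close>: one by continuity of
    \<open>f\<close>, the other by the estimate in \<open>dist (a n) a'\<close>.\<close>
  have "(\<Sum>i. a' i * f (x i)) = f L'" if f: "f \<in> dual_space sc" for f
  proof (rule LIMSEQ_unique)
    show "(\<lambda>n. f (L n)) \<longlonglongrightarrow> f L'"
      by (rule bounded_linear.tendsto[OF dual_spaceD(1)[OF f] L'])
    have "(\<lambda>n. dist (a n) a' * (\<Sum>i. norm (f (x i)))) \<longlonglongrightarrow> 0"
      using lim by (intro tendsto_mult_left_zero) (simp flip: tendsto_dist_iff)
    then have "(\<lambda>n. (\<Sum>i. a n i * f (x i)) - (\<Sum>i. a' i * f (x i))) \<longlonglongrightarrow> 0"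
      by (rule Lim_null_comparison[rotated])
        (intro always_eventually allI suminf_bcontfun_mult_diff_le[OF sum[OF f]])
    then show "(\<lambda>n. f (L n)) \<longlonglongrightarrow> (\<Sum>i. a' i * f (x i))"
      by (simp add: L[OF f] LIM_zero_iff)
  qed
  then show "a' \<in> summability_space sc p x"
    unfolding mem_summability_space_iff[OF wuc p] by blast
qed

theorem theorem4p1:
  fixes sc :: "'k::{real_normed_field, euclidean_space} \<Rightarrow> 'a::banach \<Rightarrow> 'a"
    and p :: real
    and x :: "nat \<Rightarrow> 'a"
  assumes "normed_space_over sc"
    and "0 < p"
  shows "(weakly_unconditionally_Cauchy sc x \<longleftrightarrow> complete (summability_space sc p x)) \<and>
         (complete (summability_space sc p x) \<longleftrightarrow> null_sequences \<subseteq> summability_space sc p x)"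
proof -
  interpret normed_space_over sc by fact
  let ?S = "summability_space sc p x"
  have "complete ?S" if "weakly_unconditionally_Cauchy sc x"
    unfolding complete_bcontfun_iff_closed using assms(1) that assms(2) by (rule closed_summability_space)
  moreover have "null_sequences \<subseteq> ?S" if "complete ?S"
    using assms(2) that unfolding complete_bcontfun_iff_closed by (rule null_sequences_subset_summability_space)
  moreover have "weakly_unconditionally_Cauchy sc x" if "null_sequences \<subseteq> ?S"
    using that assms(2) by (rule weakly_unconditionally_Cauchy_if_null_sequences_subset)
  ultimately show ?thesis by argo
qed

end
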